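(* Let $n$ be a positive integer. Then $$p(n)\le p(n-1)+p(n-2)-p(n-5).$$
   Context: $p(n)$ denotes the number of partitions of the positive integer $n$ (unordered representations of $n$ as a sum of positive integers), with the conventions $p(0)=1$ and $p(k)=0$ for $k<0$. *)

theory Defs
  imports Main "HOL-Library.Multiset"
begin

definition number_partitions :: "nat \<Rightarrow> nat multiset set" where
  "number_partitions n = {M. (\<forall>x \<in># M. 0 < x) \<and> sum_mset M = n}"

text \<open>The argument is an integer so that the convention \<open>p(k) = 0\<close> for \<open>k < 0\<close> can be expressed,
  and the value is an integer so that subtraction is not truncated.\<close>

definition p :: "int \<Rightarrow> int" where
  "p k = (if k < 0 then 0 else int (card (number_partitions (nat k))))"

lemma p_neg: "k < 0 \<Longrightarrow> p k = 0"
  by (simp add: p_def)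

lemma number_partitions_0: "number_partitions 0 = {{#}}"
proof -
  have "M = {#}" if "\<forall>x \<in># M. 0 < x" "sum_mset M = 0" for M :: "nat multiset"
    using that by (cases M) auto
  then show ?thesis by (auto simp: number_partitions_def)
qed

lemma p_0: "p 0 = 1"
  by (simp add: p_def number_partitions_0)

lemma finite_number_partitions: "finite (number_partitions n)"
proof (rule finite_subset)
  have size_le: "size M \<le> sum_mset M" if "\<forall>x \<in># M. 0 < x" for M :: "nat multiset"
    using that by (induction M) auto
  have mem_le: "x \<le> sum_mset M" if "x \<in># M" for x and M :: "nat multiset"
    using that by (auto dest!: multi_member_split)
  show "number_partitions n \<subseteq> mset ` {xs. set xs \<subseteq> {..n} \<and> length xs \<le> n}"
  proof
    fix M assume M: "M \<in> number_partitions n"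
    obtain xs where xs: "mset xs = M" using ex_mset by blast
    have "set xs \<subseteq> {..n}"
      using M mem_le xs by (auto simp: number_partitions_def)
    moreover have "length xs \<le> n"
      using M size_le[of M] xs by (auto simp: number_partitions_def)
    ultimately show "M \<in> mset ` {xs. set xs \<subseteq> {..n} \<and> length xs \<le> n}"
      using xs by blast
  qed
  show "finite (mset ` {xs. set xs \<subseteq> {..n} \<and> length xs \<le> n})"
    by (intro finite_imageI finite_lists_length_le) simp
qed

end

theory Submission
  imports Defs
begin

text \<open>
  Since \<open>1 - q - q\<^sup>2 + q\<^sup>5 = (1 - q\<^sup>2) (1 - q - q\<^sup>3)\<close>, the claim says that the number of partitions
  of \<open>n\<close> into parts at least 3 is at most the number of partitions of \<open>n - 3\<close> without the part 2.
  Replacing one part \<open>m\<close> of the former by \<open>m - 3\<close> ones is an injection into the latter,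
  because \<open>m\<close> can be read off the number of ones.
\<close>

text \<open>The total is an integer, so the set is empty for negative \<open>k\<close> and the
  recurrences below need no case distinction on small totals.\<close>

definition partitions_avoiding :: "nat set \<Rightarrow> int \<Rightarrow> nat multiset set" where
  "partitions_avoiding A k = {M. (\<forall>x \<in># M. 0 < x \<and> x \<notin> A) \<and> int (sum_mset M) = k}"

lemma finite_partitions_avoiding: "finite (partitions_avoiding A k)"
  by (rule finite_subset[OF _ finite_number_partitions[of "nat k"]])
    (auto simp: partitions_avoiding_def number_partitions_def simp del: of_nat_sum_mset)

lemma p_eq_card_avoiding_empty: "p k = int (card (partitions_avoiding {} k))"
proof (cases "k < 0")
  case True
  then have "partitions_avoiding {} k = {}"
    by (auto simp: partitions_avoiding_def simp del: of_nat_sum_mset)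
  with True show ?thesis by (simp add: p_neg)
next
  case False
  then have "partitions_avoiding {} k = number_partitions (nat k)"
    by (auto simp: partitions_avoiding_def number_partitions_def simp del: of_nat_sum_mset)
  with False show ?thesis by (simp add: p_def)
qed

text \<open>Removing one copy of \<open>a\<close> matches the partitions in which \<open>a\<close>
  occurs with those of \<open>k - a\<close>. In generating functions, forbidding the part
  \<open>a\<close> is multiplication by \<open>1 - q^a\<close>.\<close>

lemma card_partitions_avoiding_split:
  assumes "0 < a" "a \<notin> A"
  shows "card (partitions_avoiding A k) =
    card (partitions_avoiding (insert a A) k) + card (partitions_avoiding A (k - int a))"
proof -
  have split: "partitions_avoiding A k =
    partitions_avoiding (insert a A) k \<union> add_mset a ` partitions_avoiding A (k - int a)"
    (is "_ = ?B \<union> ?C")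
  proof (intro equalityI subsetI)
    fix M assume M: "M \<in> partitions_avoiding A k"
    show "M \<in> ?B \<union> ?C"
    proof (cases "a \<in># M")
      case True
      then obtain N where "M = add_mset a N" by (metis mset_add)
      with M show ?thesis by (auto simp: partitions_avoiding_def)
    next
      case False
      with M show ?thesis by (auto simp: partitions_avoiding_def)
    qed
  qed (use assms in \<open>auto simp: partitions_avoiding_def\<close>)
  have "a \<notin># M" if "M \<in> ?B" for M
    using that by (auto simp: partitions_avoiding_def)
  then have "?B \<inter> ?C = {}" by fastforce
  then have "card (?B \<union> ?C) = card ?B + card ?C"
    by (intro card_Un_disjoint finite_imageI finite_partitions_avoiding)
  also have "card ?C = card (partitions_avoiding A (k - int a))"
    by (simp add: card_image inj_on_def)
  finally show ?thesis by (simp only: split[symmetric])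
qed

lemma card_avoiding_12_le_card_avoiding_2:
  assumes "0 < n"
  shows "card (partitions_avoiding {1, 2} n) \<le> card (partitions_avoiding {2} (n - 3))"
proof -
  \<comment> \<open>Any choice of a part will do, since only its size has to be recovered from the
    image.\<close>
  define m :: "nat multiset \<Rightarrow> nat" where "m M = (SOME x. x \<in># M)" for M
  define f where "f M = M - {#m M#} + replicate_mset (m M - 3) 1" for M
  \<comment> \<open>The choice is meaningful because \<open>0 < n\<close> excludes the empty
    multiset.\<close>
  have in_M: "m M \<in># M" if "M \<in> partitions_avoiding {1, 2} n" for M
  proof -
    have "M \<noteq> {#}" using that assms by (auto simp: partitions_avoiding_def)
    then show ?thesis unfolding m_def by (metis multiset_nonemptyE someI)
  qed
  have ge3: "3 \<le> x" if "M \<in> partitions_avoiding {1, 2} n" "x \<in># M" for M x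
  proof -
    have "0 < x" "x \<noteq> 1" "x \<noteq> 2" using that by (auto simp: partitions_avoiding_def)
    then show ?thesis by linarith
  qed
  have "f M \<in> partitions_avoiding {2} (n - 3)" if M: "M \<in> partitions_avoiding {1, 2} n" for M
  proof -
    define N where "N = M - {#m M#}"
    have N: "add_mset (m M) N = M" using in_M[OF M] by (simp add: N_def)
    have fM: "f M = N + replicate_mset (m M - 3) 1" by (simp add: f_def N_def)
    have "int (sum_mset M) = n" using M by (simp add: partitions_avoiding_def)
    moreover have "sum_mset M = m M + sum_mset N" using arg_cong[OF N, of sum_mset] by simp
    moreover have "3 \<le> m M" using ge3 in_M M by blast
    \<comment> \<open>The parts kept are at least 3 and the new ones are 1, so 2 does not occur in
      \<open>f M\<close>.\<close>
    moreover have "3 \<le> x" if "x \<in># N" for x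
      using ge3[OF M] that unfolding N_def by (blast dest: in_diffD)
    ultimately have "int (sum_mset (f M)) = n - 3" "\<forall>x \<in># f M. x = 1 \<or> 3 \<le> x"
      by (auto simp: fM)
    then show ?thesis by (auto simp: partitions_avoiding_def)
  qed
  moreover have "inj_on f (partitions_avoiding {1, 2} n)"
  proof (rule inj_onI)
    fix M N assume M: "M \<in> partitions_avoiding {1, 2} n"
      and N: "N \<in> partitions_avoiding {1, 2} n" and eq: "f M = f N"
    \<comment> \<open>\<open>K\<close> has no part 1, so every 1 in \<open>f K\<close> comes from
      the replacement.\<close>
    have count1: "count (f K) 1 = m K - 3" if "K \<in> partitions_avoiding {1, 2} n" for K
    proof -
      have "1 \<notin># K" using ge3[OF that, of 1] by auto
      then have "count K 1 = 0" by (simp add: not_in_iff)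
      then show ?thesis by (simp add: f_def)
    qed
    have "m M - 3 = m N - 3" using count1[OF M] count1[OF N] eq by simp
    moreover have "3 \<le> m M" "3 \<le> m N" using ge3 in_M M N by blast+
    \<comment> \<open>The bound 3 on both parts makes the truncated subtraction cancellable.\<close>
    ultimately have m: "m M = m N" by linarith
    then have "M - {#m M#} = N - {#m N#}" using eq by (simp add: f_def)
    then show "M = N" using m in_M[OF M] in_M[OF N] by (metis insert_DiffM)
  qed
  ultimately show ?thesis
    by (meson card_inj_on_le finite_partitions_avoiding image_subsetI)
qed

theorem theorem4:
  fixes n :: int
  assumes "0 < n"
  shows "p n \<le> p (n - 1) + p (n - 2) - p (n - 5)"
proof -
  let ?c = "\<lambda>A k. card (partitions_avoiding A k)"
  have "?c {} k = ?c {2} k + ?c {} (k - 2)" for k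
    using card_partitions_avoiding_split[of 2 "{}" k] by simp
  \<comment> \<open>With these instances the terms at \<open>n - 3\<close> for \<open>{}\<close>
    cancel, and \<open>p n - p (n - 1) - p (n - 2) + p (n - 5)\<close> becomes
    \<open>?c {2} n - ?c {2} (n - 1) - ?c {2} (n - 3)\<close>. Splitting off the part 1 turns this
    into \<open>?c {1, 2} n - ?c {2} (n - 3)\<close>.\<close>
  from this[of n] this[of "n - 1"] this[of "n - 3"]
  have "?c {} n = ?c {2} n + ?c {} (n - 2)"
    "?c {} (n - 1) = ?c {2} (n - 1) + ?c {} (n - 3)"
    "?c {} (n - 3) = ?c {2} (n - 3) + ?c {} (n - 5)"
    by simp_all
  moreover have "?c {2} n = ?c {1, 2} n + ?c {2} (n - 1)"
    using card_partitions_avoiding_split[of 1 "{2}" n] by simp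
  moreover have "?c {1, 2} n \<le> ?c {2} (n - 3)"
    by (rule card_avoiding_12_le_card_avoiding_2[OF assms])
  ultimately show ?thesis
    unfolding p_eq_card_avoiding_empty by linarith
qed

end
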